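(* Let $M:[0,\infty)^n\to\mathsf{Vec}$ be a constructible persistence module, let $\ell\subseteq[0,\infty)^n$ be a line with nonnegative slope, let $\iota:[0,\infty)\hookrightarrow[0,\infty)^n$ be the (order-preserving) inclusion of $\ell$ into $[0,\infty)^n$, and let $\pi:[0,\infty)^n\to\ell$ be the left adjoint of $\iota$, defined by $\pi(x)=\min\{a\in\ell\mid x\le\iota(a)\}$. Then the persistence diagram of the 1-parameter persistence module $M|_\ell\cong M\circ\iota$ is given by $\pi_\sharp(\partial\,\mathsf{null}_M)$.
   Context: Fix a field $\mathbb{K}$; $\mathsf{Vec}$ is the category of finite-dimensional $\mathbb{K}$-vector spaces. A persistence module is a functor $M:P\to\mathsf{Vec}$ from a poset $P$; $[0,\infty)^n$ has the product order. A co-closure operator on $P$ is an order-preserving map $c:P\to P$ with $c(p)\le p$ for all $p$ and $c\circ c=c$. $M$ is constructible if there is a co-closure operator $c$ with finite image such that $M\circ c\cong M$. The line $\ell$ is identified with the totally ordered set $[0,\infty)$ through $\iota$, whose image is $\ell$. Since $\ell$ has nonnegative slope, $\iota$ is order-preserving; moreover, $\iota$ has a left adjoint $\pi$, meaning an order-preserving map with $\pi(x)\le a\iff x\le\iota(a)$ for all $x\in[0,\infty)^n$ and $a\in\ell\cong[0,\infty)$. For a poset $P$, $\bar P=\{(a,b)\in P\times P:a\le b\}$ with the product order, and an order-preserving $h:P\to Q$ induces $\bar h:\bar P\to\bar Q$, $\bar h(a,b)=(h(a),h(b))$. For $w:\bar P\to\mathbb{Z}$ finitely supported, $h_\sharp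 w$ here means the pushforward along $\bar h$: $(h_\sharp w)(J)=\sum_{I\in\bar h^{-1}(J)}w(I)$. The nullity function is $\mathsf{null}_M:\bar P\to\mathbb{Z}$, $\mathsf{null}_M(a,b)=\dim\ker M(a\le b)$. For a function $m:X\to\mathbb{Z}$ on a poset $X$, its Möbius inversion is the (unique, if it exists) function $\partial m:X\to\mathbb{Z}$ with $m(y)=\sum_{x\le y}\partial m(x)$ for all $y$, each sum having finitely many nonzero terms. For constructible $M$, $\partial\,\mathsf{null}_M$ exists and is finitely supported. A persistence diagram of a constructible $M:P\to\mathsf{Vec}$ is a finitely supported function $\bar P\to\mathbb{Z}$ that agrees with $\partial\,\mathsf{null}_M$ on all $(a,b)$ with $a<b$; in particular $\partial\,\mathsf{null}_M$ itself is one. *)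

theory Defs
  imports "HOL-Analysis.Analysis" "Jordan_Normal_Form.Missing_VectorSpace"
begin

text \<open>
  A poset is a carrier set \<open>P\<close> in a type of class \<open>order\<close>. Functions on it are HOL functions of
  which only the values on \<open>P\<close> matter. The objects of \<open>Vec\<close> are module records over a field record
  \<open>K\<close>, each with its own carrier and operations.
\<close>

record ('a, 'k, 'v) pmod =
  pm_obj :: "'a \<Rightarrow> ('k, 'v) module"
  pm_map :: "'a \<Rightarrow> 'a \<Rightarrow> 'v \<Rightarrow> 'v"

locale persistence_module = field K
  for K :: "'k ring" +
  fixes P :: "'a::order set" and M :: "('a, 'k, 'v) pmod"
  assumes obj_vectorspace: "p \<in> P \<Longrightarrow> vectorspace K (pm_obj M p)"
    and obj_fin_dim: "p \<in> P \<Longrightarrow> vectorspace.fin_dim K (pm_obj M p)"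
    and map_linear: "\<lbrakk>p \<in> P; q \<in> P; p \<le> q\<rbrakk> \<Longrightarrow>
      linear_map K (pm_obj M p) (pm_obj M q) (pm_map M p q)"
    and map_id: "\<lbrakk>p \<in> P; x \<in> carrier (pm_obj M p)\<rbrakk> \<Longrightarrow> pm_map M p p x = x"
    and map_comp: "\<lbrakk>p \<in> P; q \<in> P; r \<in> P; p \<le> q; q \<le> r; x \<in> carrier (pm_obj M p)\<rbrakk> \<Longrightarrow>
      pm_map M q r (pm_map M p q x) = pm_map M p r x"

definition pm_comp :: "('b, 'k, 'v) pmod \<Rightarrow> ('a \<Rightarrow> 'b) \<Rightarrow> ('a, 'k, 'v) pmod" where
  "pm_comp M h = \<lparr>pm_obj = (\<lambda>a. pm_obj M (h a)), pm_map = (\<lambda>a b. pm_map M (h a) (h b))\<rparr>"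

text \<open>A linear bijection has a linear inverse, so this is natural isomorphism of functors.\<close>

definition pm_iso ::
  "'k ring \<Rightarrow> 'a::order set \<Rightarrow> ('a, 'k, 'v) pmod \<Rightarrow> ('a, 'k, 'v) pmod \<Rightarrow> bool" where
  "pm_iso K P M N \<longleftrightarrow> (\<exists>\<eta>.
     (\<forall>p\<in>P. linear_map K (pm_obj M p) (pm_obj N p) (\<eta> p) \<and>
            bij_betw (\<eta> p) (carrier (pm_obj M p)) (carrier (pm_obj N p))) \<and>
     (\<forall>p\<in>P. \<forall>q\<in>P. p \<le> q \<longrightarrow> (\<forall>x\<in>carrier (pm_obj M p).
            \<eta> q (pm_map M p q x) = pm_map N p q (\<eta> p x))))"

definition co_closure_operator :: "'a::order set \<Rightarrow> ('a \<Rightarrow> 'a) \<Rightarrow> bool" where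
  "co_closure_operator P c \<longleftrightarrow>
     c \<in> P \<rightarrow> P \<and> mono_on P c \<and> (\<forall>p\<in>P. c p \<le> p) \<and> (\<forall>p\<in>P. c (c p) = c p)"

definition constructible :: "'k ring \<Rightarrow> 'a::order set \<Rightarrow> ('a, 'k, 'v) pmod \<Rightarrow> bool" where
  "constructible K P M \<longleftrightarrow>
     (\<exists>c. co_closure_operator P c \<and> finite (c ` P) \<and> pm_iso K P (pm_comp M c) M)"

text \<open>The order on pairs is the product order of \<open>HOL-Library.Product_Order\<close>.\<close>

definition intervals :: "'a::order set \<Rightarrow> ('a \<times> 'a) set" where
  "intervals P = {(a, b). a \<in> P \<and> b \<in> P \<and> a \<le> b}"

definition nullity :: "'k ring \<Rightarrow> ('a, 'k, 'v) pmod \<Rightarrow> 'a \<times> 'a \<Rightarrow> int" where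
  "nullity K M = (\<lambda>(a, b). int (vectorspace.dim K
     ((pm_obj M a)\<lparr>carrier := mod_hom.ker (pm_obj M a) (pm_obj M b) (pm_map M a b)\<rparr>)))"

definition is_moebius_inversion ::
  "'x::order set \<Rightarrow> ('x \<Rightarrow> int) \<Rightarrow> ('x \<Rightarrow> int) \<Rightarrow> bool" where
  "is_moebius_inversion X m d \<longleftrightarrow>
     (\<forall>y\<in>X. finite {x \<in> X. x \<le> y \<and> d x \<noteq> 0} \<and>
            m y = (\<Sum>x | x \<in> X \<and> x \<le> y \<and> d x \<noteq> 0. d x))"

text \<open>
  The value \<open>0\<close> off \<open>X\<close> only makes the description unique as a total function. If \<open>m\<close> has no
  Moebius inversion, \<open>moebius_inversion X m\<close> is unspecified.
\<close>

definition moebius_inversion :: "'x::order set \<Rightarrow> ('x \<Rightarrow> int) \<Rightarrow> 'x \<Rightarrow> int" where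
  "moebius_inversion X m =
     (THE d. is_moebius_inversion X m d \<and> (\<forall>x. x \<notin> X \<longrightarrow> d x = 0))"

text \<open>
  Restricting the sum to the support of \<open>w\<close> keeps it finite for finitely supported \<open>w\<close>, also over
  infinite fibres.
\<close>

definition pushforward ::
  "'a::order set \<Rightarrow> ('a \<Rightarrow> 'b) \<Rightarrow> ('a \<times> 'a \<Rightarrow> int) \<Rightarrow> 'b \<times> 'b \<Rightarrow> int" where
  "pushforward P h w J =
     (\<Sum>I | I \<in> intervals P \<and> map_prod h h I = J \<and> w I \<noteq> 0. w I)"

definition is_persistence_diagram ::
  "'k ring \<Rightarrow> 'a::order set \<Rightarrow> ('a, 'k, 'v) pmod \<Rightarrow> ('a \<times> 'a \<Rightarrow> int) \<Rightarrow> bool" where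
  "is_persistence_diagram K P M w \<longleftrightarrow>
     persistence_module K P M \<and> constructible K P M \<and>
     finite {I \<in> intervals P. w I \<noteq> 0} \<and>
     (\<forall>a\<in>P. \<forall>b\<in>P. a < b \<longrightarrow> w (a, b) = moebius_inversion (intervals P) (nullity K M) (a, b))"

text \<open>
  \<open>{0..}\<close> in \<open>real^'n\<close> is the nonnegative orthant, as the order there is componentwise. A line in
  the orthant is its intersection with a line of \<open>real^'n\<close>.
\<close>

definition nonneg_slope_line :: "(real^'n) set \<Rightarrow> bool" where
  "nonneg_slope_line L \<longleftrightarrow>
     (\<exists>p v. 0 \<le> p \<and> 0 \<le> v \<and> v \<noteq> 0 \<and> L = {p + t *\<^sub>R v | t. True} \<inter> {0..})"

definition left_adjoint ::
  "'a::order set \<Rightarrow> 'b::order set \<Rightarrow> ('a \<Rightarrow> 'b) \<Rightarrow> ('b \<Rightarrow> 'a) \<Rightarrow> bool" where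
  "left_adjoint P Q f g \<longleftrightarrow>
     f \<in> P \<rightarrow> Q \<and> mono_on P f \<and> (\<forall>x\<in>P. \<forall>a\<in>Q. f x \<le> a \<longleftrightarrow> x \<le> g a)"

lemma left_adjoint_eq_Least:
  assumes "left_adjoint P Q f g" "x \<in> P"
  shows "f x = (LEAST a. a \<in> Q \<and> x \<le> g a)"
  using assms unfolding left_adjoint_def
  by (intro Least_equality[symmetric]) (auto simp: Pi_iff)

end

theory Submission
  imports Defs
begin

text \<open>
  Write \<open>w\<close> for the Moebius inversion of the nullity function of \<open>M\<close>, and let \<open>\<pi>\<close> be left
  adjoint to \<open>\<iota>\<close>. The nullity of \<open>M \<circ> \<iota>\<close> at an interval \<open>J\<close> is the nullity of \<open>M\<close> at the image
  of \<open>J\<close> under \<open>\<iota>\<close>, so it is the sum of \<open>w\<close> over all intervals \<open>I\<close> below that image. By the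
  adjunction, applied to both endpoints, these are exactly the \<open>I\<close> whose image under \<open>\<pi>\<close> is below
  \<open>J\<close>. Collecting the terms with the same image turns the sum into the sum of the pushforward of
  \<open>w\<close> over all intervals below \<open>J\<close>. Hence the pushforward satisfies the equation that
  characterises the Moebius inversion of the nullity function of \<open>M \<circ> \<iota>\<close>, and Moebius inversions
  are unique (\<open>moebius_inversion_pushforward\<close>, \<open>moebius_inversion_eqI\<close>). The two functions thus agree
  on all intervals, the diagonal included.

  This needs \<open>w\<close> to exist and to have finite support. Let \<open>c\<close> be a co-closure operator with
  finite image and \<open>M \<circ> c \<cong> M\<close>. The structure maps of \<open>M\<close> between points with the same image
  under \<open>c\<close> are isomorphisms (\<open>map_bij_if_coclosure_eq\<close>), so replacing both endpoints of an interval
  by their images under \<open>c\<close> preserves the nullity (\<open>nullity_coclosure\<close>). The inversion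
  then takes place on a finite poset (\<open>moebius_inversion_co_closure\<close>).

  Finally, \<open>\<pi> \<circ> c \<circ> \<iota>\<close> is a co-closure operator that exhibits \<open>M \<circ> \<iota>\<close> as constructible
  (\<open>constructible_pm_comp_right_adjoint\<close>).
\<close>

section \<open>Moebius inversion\<close>

text \<open>
  Two inversions differ at only finitely many points below \<open>y\<close>. At a minimal such point all other
  terms of the two sums agree, and so do the sums; hence the values there agree as well.
\<close>

lemma moebius_inversion_unique:
  fixes d e :: "'x::order \<Rightarrow> int"
  assumes d: "is_moebius_inversion X m d" and e: "is_moebius_inversion X m e" and y: "y \<in> X"
  shows "d y = e y"
proof (rule ccontr)
  assume ne: "d y \<noteq> e y"
  \<comment> \<open>Over the union of the two supports, both inversions are summed over the same finite set.\<close>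
  have sums: "finite {x \<in> X. x \<le> z \<and> (d x \<noteq> 0 \<or> e x \<noteq> 0)} \<and>
      m z = sum d {x \<in> X. x \<le> z \<and> (d x \<noteq> 0 \<or> e x \<noteq> 0)} \<and>
      m z = sum e {x \<in> X. x \<le> z \<and> (d x \<noteq> 0 \<or> e x \<noteq> 0)}" (is "finite ?U \<and> _") if "z \<in> X" for z
  proof (intro conjI)
    have fin_d: "finite {x \<in> X. x \<le> z \<and> d x \<noteq> 0}" and md: "m z = sum d {x \<in> X. x \<le> z \<and> d x \<noteq> 0}"
      and fin_e: "finite {x \<in> X. x \<le> z \<and> e x \<noteq> 0}" and me: "m z = sum e {x \<in> X. x \<le> z \<and> e x \<noteq> 0}"
      using d e that by (auto simp: is_moebius_inversion_def)
    have "?U = {x \<in> X. x \<le> z \<and> d x \<noteq> 0} \<union> {x \<in> X. x \<le> z \<and> e x \<noteq> 0}"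
      by auto
    with fin_d fin_e show fin: "finite ?U"
      by simp
    show "m z = sum d ?U"
      unfolding md using fin by (intro sum.mono_neutral_left) auto
    show "m z = sum e ?U"
      unfolding me using fin by (intro sum.mono_neutral_left) auto
  qed
  define D where "D = {x \<in> X. x \<le> y \<and> d x \<noteq> e x}"
  have "D \<subseteq> {x \<in> X. x \<le> y \<and> (d x \<noteq> 0 \<or> e x \<noteq> 0)}"
    by (auto simp: D_def)
  then have "finite D"
    using sums[OF y] finite_subset by blast
  moreover have "D \<noteq> {}"
    using y ne by (auto simp: D_def)
  ultimately obtain z where z: "z \<in> D" and min: "\<And>x. x \<in> D \<Longrightarrow> x \<le> z \<Longrightarrow> z = x"
    using finite_has_minimal by metis
  let ?U = "{x \<in> X. x \<le> z \<and> (d x \<noteq> 0 \<or> e x \<noteq> 0)}"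
  have zX: "z \<in> X" "z \<le> y" "d z \<noteq> e z"
    using z by (auto simp: D_def)
  have fin: "finite ?U" and eq: "sum d ?U = sum e ?U"
    using sums[OF zX(1)] by auto
  have "d x = e x" if "x \<in> ?U - {z}" for x
  proof (rule ccontr)
    assume "d x \<noteq> e x"
    then have "x \<in> D"
      using that zX by (auto simp: D_def)
    with min that show False
      by blast
  qed
  then have "sum d (?U - {z}) = sum e (?U - {z})"
    by (rule sum.cong[OF refl])
  moreover have "z \<in> ?U"
    using zX by auto
  ultimately show False
    using eq zX(3) sum.remove[OF fin, of z d] sum.remove[OF fin, of z e] by linarith
qed

lemma moebius_inversion_eqI:
  assumes "is_moebius_inversion X m d" and "\<And>x. x \<notin> X \<Longrightarrow> d x = 0"
  shows "moebius_inversion X m = d"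
  unfolding moebius_inversion_def
proof (rule the_equality)
  fix e assume e: "is_moebius_inversion X m e \<and> (\<forall>x. x \<notin> X \<longrightarrow> e x = 0)"
  show "e = d"
  proof
    show "e x = d x" for x
      using moebius_inversion_unique[of X m e d x] e assms by (cases "x \<in> X") auto
  qed
qed (use assms in auto)

text \<open>
  Induction on the set, removing a maximal element: its value enters no equation but its own, so it
  can be chosen last.
\<close>

lemma finite_moebius_inversion_exists:
  fixes m :: "'x::order \<Rightarrow> int"
  assumes "finite F"
  shows "\<exists>d. (\<forall>x. x \<notin> F \<longrightarrow> d x = 0) \<and> (\<forall>y\<in>F. m y = sum d {x \<in> F. x \<le> y})"
  using assms
proof (induction F rule: finite_psubset_induct)
  case (psubset F)
  show ?case
  proof (cases "F = {}")
    case False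
    then obtain t where t: "t \<in> F" and max: "\<And>x. x \<in> F \<Longrightarrow> t \<le> x \<Longrightarrow> t = x"
      using finite_has_maximal[OF psubset.hyps] by metis
    have "F - {t} \<subset> F"
      using t by auto
    from psubset.IH[OF this] obtain d where d0: "\<And>x. x \<notin> F - {t} \<Longrightarrow> d x = 0"
      and d: "\<And>y. y \<in> F - {t} \<Longrightarrow> m y = sum d {x \<in> F - {t}. x \<le> y}"
      by blast
    define d' where "d' = d(t := m t - sum d {x \<in> F - {t}. x \<le> t})"
    have d'_eq: "sum d' {x \<in> F - {t}. x \<le> y} = sum d {x \<in> F - {t}. x \<le> y}" for y
      by (rule sum.cong) (auto simp: d'_def)
    have "m y = sum d' {x \<in> F. x \<le> y}" if y: "y \<in> F" for y
    proof (cases "y = t")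
      case True
      have "{x \<in> F. x \<le> t} = insert t {x \<in> F - {t}. x \<le> t}"
        using t by auto
      then have "sum d' {x \<in> F. x \<le> t} = d' t + sum d' {x \<in> F - {t}. x \<le> t}"
        using psubset.hyps by simp
      then show ?thesis
        by (simp add: True d'_eq) (simp add: d'_def)
    next
      case False
      then have "{x \<in> F. x \<le> y} = {x \<in> F - {t}. x \<le> y}"
        using max y by auto
      then show ?thesis
        using d[of y] d'_eq[of y] y False by simp
    qed
    moreover have "d' x = 0" if "x \<notin> F" for x
      using that t d0 by (auto simp: d'_def)
    ultimately show ?thesis
      by blast
  qed auto
qed

text \<open>
  If \<open>m\<close> factors through \<open>c\<close>, the inversion on the finite poset \<open>c ` X\<close>, extended by zero, is an
  inversion on \<open>X\<close>: a fixed point of \<open>c\<close> is below \<open>y\<close> if and only if it is below \<open>c y\<close>.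
\<close>

lemma moebius_inversion_co_closure:
  assumes c: "co_closure_operator X c" and fin: "finite (c ` X)"
    and inv: "\<And>x. x \<in> X \<Longrightarrow> m (c x) = m x"
  shows "is_moebius_inversion X m (moebius_inversion X m)"
    and "finite {x. moebius_inversion X m x \<noteq> 0}"
proof -
  obtain d where d0: "\<And>x. x \<notin> c ` X \<Longrightarrow> d x = 0"
    and d: "\<And>y. y \<in> c ` X \<Longrightarrow> m y = sum d {x \<in> c ` X. x \<le> y}"
    using finite_moebius_inversion_exists[OF fin, of m] by auto
  have cX: "c x \<in> X" "c x \<le> x" "c (c x) = c x" if "x \<in> X" for x
    using c that by (auto simp: co_closure_operator_def)
  have c_mono: "c x \<le> c y" if "x \<in> X" "y \<in> X" "x \<le> y" for x y
    using c that by (auto simp: co_closure_operator_def dest: mono_onD)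
  have sub: "c ` X \<subseteq> X"
    using cX by auto
  have "finite {x \<in> X. x \<le> y \<and> d x \<noteq> 0}" for y
    by (rule finite_subset[OF _ fin]) (use d0 in auto)
  moreover have "m y = sum d {x \<in> X. x \<le> y \<and> d x \<noteq> 0}" if y: "y \<in> X" for y
  proof -
    have "x \<le> c y" if "x \<in> c ` X" "x \<le> y" for x
      using that cX c_mono y by (metis imageE)
    then have below: "{x \<in> c ` X. x \<le> c y} = {x \<in> c ` X. x \<le> y}"
      using cX[OF y] by (auto intro: order_trans)
    have "m y = sum d {x \<in> c ` X. x \<le> y}"
      using d[of "c y"] inv[OF y] y below by simp
    also have "\<dots> = sum d {x \<in> X. x \<le> y \<and> d x \<noteq> 0}"
      using fin sub d0 by (intro sum.mono_neutral_right) auto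
    finally show ?thesis .
  qed
  ultimately have "is_moebius_inversion X m d"
    by (simp add: is_moebius_inversion_def)
  moreover from this have "moebius_inversion X m = d"
    by (rule moebius_inversion_eqI) (use d0 sub in auto)
  moreover have "finite {x. d x \<noteq> 0}"
    by (rule finite_subset[OF _ fin]) (use d0 in auto)
  ultimately show "is_moebius_inversion X m (moebius_inversion X m)"
    and "finite {x. moebius_inversion X m x \<noteq> 0}"
    by simp_all
qed

section \<open>Intervals and adjunctions\<close>

lemma map_prod_intervals:
  assumes "h \<in> P \<rightarrow> Q" "mono_on P h" "I \<in> intervals P"
  shows "map_prod h h I \<in> intervals Q"
  using assms by (auto simp: intervals_def dest: mono_onD)

lemma co_closure_operator_intervals:
  assumes "co_closure_operator P c"
  shows "co_closure_operator (intervals P) (map_prod c c)"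
  using assms
  by (auto simp: co_closure_operator_def intervals_def mono_on_def less_eq_prod_def)

lemma finite_image_intervals:
  assumes "finite (c ` P)"
  shows "finite (map_prod c c ` intervals P)"
proof (rule finite_subset)
  show "map_prod c c ` intervals P \<subseteq> c ` P \<times> c ` P"
    by (auto simp: intervals_def)
qed (use assms in simp)

lemma right_adjoint_mono:
  assumes adj: "left_adjoint P Q f g" and g: "g \<in> Q \<rightarrow> P"
  shows "mono_on Q g"
proof (rule mono_onI)
  fix a b assume ab: "a \<in> Q" "b \<in> Q" "a \<le> b"
  then have "g a \<in> P" "g b \<in> P"
    using g by auto
  with adj ab have "f (g a) \<le> a"
    by (auto simp: left_adjoint_def)
  then have "f (g a) \<le> b"
    using ab by simp
  with adj ab \<open>g a \<in> P\<close> show "g a \<le> g b"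
    by (auto simp: left_adjoint_def)
qed

lemma pushforward_nonzeroE:
  assumes "pushforward P h w J \<noteq> 0"
  obtains I where "I \<in> intervals P" "map_prod h h I = J" "w I \<noteq> 0"
proof -
  have "{I. I \<in> intervals P \<and> map_prod h h I = J \<and> w I \<noteq> 0} \<noteq> {}"
    using assms unfolding pushforward_def by (metis (mono_tags, lifting) sum.empty)
  with that show ?thesis
    by blast
qed

lemma finite_support_pushforward:
  assumes "finite {I. w I \<noteq> 0}"
  shows "finite {J. pushforward P h w J \<noteq> 0}"
proof (rule finite_subset)
  show "{J. pushforward P h w J \<noteq> 0} \<subseteq> map_prod h h ` {I. w I \<noteq> 0}"
    by (blast elim: pushforward_nonzeroE)
qed (use assms in simp)

text \<open>
  On intervals, too, \<open>f\<close> is left adjoint to \<open>g\<close>. So the pushforward, summed over the intervals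
  below \<open>J\<close>, collects exactly the values of \<open>w\<close> below the image of \<open>J\<close> under \<open>g\<close>.
\<close>

lemma moebius_inversion_pushforward:
  assumes adj: "left_adjoint P Q f g" and g: "g \<in> Q \<rightarrow> P"
    and w: "is_moebius_inversion (intervals P) m w" and fin: "finite {I. w I \<noteq> 0}"
  shows "is_moebius_inversion (intervals Q) (m \<circ> map_prod g g) (pushforward P f w)"
  unfolding is_moebius_inversion_def
proof (intro ballI conjI)
  fix J assume J: "J \<in> intervals Q"
  let ?T = "{J' \<in> intervals Q. J' \<le> J \<and> pushforward P f w J' \<noteq> 0}"
  let ?S = "{I \<in> intervals P. I \<le> map_prod g g J \<and> w I \<noteq> 0}"
  \<comment> \<open>\<open>?B\<close> may be larger than \<open>?T\<close>, since values of \<open>w\<close> with the same image can cancel.\<close>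
  let ?B = "{J' \<in> intervals Q. J' \<le> J \<and> J' \<in> map_prod f f ` {I. w I \<noteq> 0}}"
  show finT: "finite ?T"
    by (rule finite_subset[OF _ finite_support_pushforward[OF fin, of P f]]) auto
  have finB: "finite ?B"
    using fin by (intro finite_subset[of ?B "map_prod f f ` {I. w I \<noteq> 0}"]) auto
  have finS: "finite ?S"
    by (rule finite_subset[OF _ fin]) auto
  have f: "f \<in> P \<rightarrow> Q" "mono_on P f"
    using adj by (auto simp: left_adjoint_def)
  have gJ: "map_prod g g J \<in> intervals P"
    using map_prod_intervals[OF g right_adjoint_mono[OF adj g] J] .
  have adj': "map_prod f f I \<le> J \<longleftrightarrow> I \<le> map_prod g g J" if "I \<in> intervals P" for I
    using adj that J by (cases I; cases J) (auto simp: left_adjoint_def intervals_def)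
  have "(m \<circ> map_prod g g) J = sum w ?S"
    using w gJ by (simp add: is_moebius_inversion_def)
  also have "\<dots> = (\<Sum>J'\<in>?B. sum w {I \<in> ?S. map_prod f f I = J'})"
    by (rule sum.group[symmetric, OF finS finB])
      (use adj' map_prod_intervals[OF f] in auto)
  also have "\<dots> = (\<Sum>J'\<in>?B. pushforward P f w J')"
  proof (rule sum.cong[OF refl])
    fix J' assume "J' \<in> ?B"
    then have "{I \<in> ?S. map_prod f f I = J'} =
        {I. I \<in> intervals P \<and> map_prod f f I = J' \<and> w I \<noteq> 0}"
      using adj' by blast
    then show "sum w {I \<in> ?S. map_prod f f I = J'} = pushforward P f w J'"
      by (simp add: pushforward_def)
  qed
  also have "\<dots> = sum (pushforward P f w) ?T"
  proof (rule sum.mono_neutral_right[OF finB])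
    show "?T \<subseteq> ?B"
    proof
      fix J' assume J': "J' \<in> ?T"
      then have "pushforward P f w J' \<noteq> 0"
        by simp
      then obtain I where "map_prod f f I = J'" "w I \<noteq> 0"
        by (rule pushforward_nonzeroE)
      with J' show "J' \<in> ?B"
        by auto
    qed
  qed auto
  finally show "(m \<circ> map_prod g g) J = sum (pushforward P f w) ?T" .
qed

section \<open>Dimension of kernels\<close>

text \<open>
  The two maps have the same image and domains of the same dimension, so the rank-nullity theorem
  gives their kernels the same dimension.
\<close>

lemma dim_ker_precompose_bij:
  assumes f: "linear_map K V W f" and e: "linear_map K V' V e" and g: "linear_map K V' W g"
    and g_eq: "\<And>x. x \<in> carrier V' \<Longrightarrow> g x = f (e x)"
    and bij: "bij_betw e (carrier V') (carrier V)"
    and fin_V: "vectorspace.fin_dim K V" and fin_V': "vectorspace.fin_dim K V'"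
  shows "vectorspace.dim K (V\<lparr>carrier := mod_hom.ker V W f\<rparr>) =
    vectorspace.dim K (V'\<lparr>carrier := mod_hom.ker V' W g\<rparr>)"
proof -
  interpret f: linear_map K V W f by fact
  interpret e: linear_map K V' V e by fact
  interpret g: linear_map K V' W g by fact
  have "g ` carrier V' = f ` e ` carrier V'"
    using g_eq by (force simp: image_image)
  then have "g.imT = f.imT"
    using bij by (simp add: f.im_def g.im_def bij_betw_def)
  moreover have "vectorspace.dim K V' = vectorspace.dim K V"
    using bij by (intro e.dim_eq fin_V') (auto simp: bij_betw_def)
  ultimately show ?thesis
    using f.rank_nullity[OF fin_V] g.rank_nullity[OF fin_V'] by simp
qed

lemma ker_postcompose_inj:
  assumes f: "linear_map K V W f" and i: "linear_map K W W' i" and g: "linear_map K V W' g"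
    and g_eq: "\<And>x. x \<in> carrier V \<Longrightarrow> g x = i (f x)"
    and inj: "inj_on i (carrier W)"
  shows "mod_hom.ker V W' g = mod_hom.ker V W f"
proof -
  interpret f: linear_map K V W f by fact
  interpret i: linear_map K W W' i by fact
  interpret g: linear_map K V W' g by fact
  have "i (f x) = \<zero>\<^bsub>W'\<^esub> \<longleftrightarrow> f x = \<zero>\<^bsub>W\<^esub>" if "x \<in> carrier V" for x
    using inj_on_eq_iff[OF inj, of "f x" "\<zero>\<^bsub>W\<^esub>"] that by simp
  then show ?thesis
    by (auto simp: f.ker_def g.ker_def g_eq)
qed

section \<open>Constructible persistence modules\<close>

text \<open>
  For \<open>c p = c q\<close> the map of \<open>M \<circ> c\<close> from \<open>p\<close> to \<open>q\<close> is an identity, so naturality of the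
  isomorphism \<open>\<eta>\<close> reads \<open>M(p \<le> q) \<circ> \<eta> p = \<eta> q\<close>.
\<close>

lemma map_bij_if_coclosure_eq:
  assumes M: "persistence_module K P M"
    and c: "co_closure_operator P c" and iso: "pm_iso K P (pm_comp M c) M"
    and pq: "p \<in> P" "q \<in> P" "p \<le> q" and eq: "c p = c q"
  shows "bij_betw (pm_map M p q) (carrier (pm_obj M p)) (carrier (pm_obj M q))"
proof -
  interpret persistence_module K P M by fact
  from iso[unfolded pm_iso_def] obtain \<eta> where
    "(\<forall>p\<in>P. linear_map K (pm_obj (pm_comp M c) p) (pm_obj M p) (\<eta> p) \<and>
        bij_betw (\<eta> p) (carrier (pm_obj (pm_comp M c) p)) (carrier (pm_obj M p))) \<and>
      (\<forall>p\<in>P. \<forall>q\<in>P. p \<le> q \<longrightarrow> (\<forall>x\<in>carrier (pm_obj (pm_comp M c) p).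
        \<eta> q (pm_map (pm_comp M c) p q x) = pm_map M p q (\<eta> p x)))" ..
  then have \<eta>: "\<And>p. p \<in> P \<Longrightarrow>
      bij_betw (\<eta> p) (carrier (pm_obj M (c p))) (carrier (pm_obj M p))"
    and nat: "\<And>p q x. \<lbrakk>p \<in> P; q \<in> P; p \<le> q; x \<in> carrier (pm_obj M (c p))\<rbrakk> \<Longrightarrow>
      \<eta> q (pm_map M (c p) (c q) x) = pm_map M p q (\<eta> p x)"
    by (simp_all add: pm_comp_def)
  have "c p \<in> P"
    using c pq by (auto simp: co_closure_operator_def)
  then have "(pm_map M p q \<circ> \<eta> p) x = \<eta> q x" if "x \<in> carrier (pm_obj M (c p))" for x
    using nat[OF pq that] that eq map_id by simp
  then have "bij_betw (pm_map M p q \<circ> \<eta> p) (carrier (pm_obj M (c p))) (carrier (pm_obj M q))"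
    using \<eta>[OF pq(2)] unfolding eq by (subst bij_betw_cong)
  then show ?thesis
    using bij_betw_comp_iff[OF \<eta>[OF pq(1)]] by blast
qed

text \<open>
  Pass from \<open>(a, b)\<close> to \<open>(c a, b)\<close> by precomposing with the isomorphism \<open>M(c a \<le> a)\<close>, and from
  there to \<open>(c a, c b)\<close>, where postcomposing with the isomorphism \<open>M(c b \<le> b)\<close> does not change
  the kernel.
\<close>

lemma nullity_coclosure:
  assumes M: "persistence_module K P M"
    and c: "co_closure_operator P c" and iso: "pm_iso K P (pm_comp M c) M"
    and I: "I \<in> intervals P"
  shows "nullity K M (map_prod c c I) = nullity K M I"
proof -
  interpret persistence_module K P M by fact
  obtain a b where I_eq: "I = (a, b)" and ab: "a \<in> P" "b \<in> P" "a \<le> b"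
    using I by (auto simp: intervals_def)
  have cP: "c p \<in> P" "c p \<le> p" "c (c p) = c p" if "p \<in> P" for p
    using c that by (auto simp: co_closure_operator_def)
  have cab: "c a \<le> c b"
    using c ab by (auto simp: co_closure_operator_def dest: mono_onD)
  have cab': "c a \<le> b"
    using cab cP[OF ab(2)] by simp
  have bij: "bij_betw (pm_map M (c p) p) (carrier (pm_obj M (c p))) (carrier (pm_obj M p))"
    if "p \<in> P" for p
    using map_bij_if_coclosure_eq[OF M c iso] cP that by simp
  have "vectorspace.dim K
      ((pm_obj M a)\<lparr>carrier := mod_hom.ker (pm_obj M a) (pm_obj M b) (pm_map M a b)\<rparr>) =
    vectorspace.dim K
      ((pm_obj M (c a))\<lparr>carrier := mod_hom.ker (pm_obj M (c a)) (pm_obj M b) (pm_map M (c a) b)\<rparr>)"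
    using ab cP cab' bij
    by (intro dim_ker_precompose_bij[where e = "pm_map M (c a) a"] map_linear obj_fin_dim)
      (auto simp: map_comp)
  also have "mod_hom.ker (pm_obj M (c a)) (pm_obj M b) (pm_map M (c a) b) =
      mod_hom.ker (pm_obj M (c a)) (pm_obj M (c b)) (pm_map M (c a) (c b))"
    using ab cP cab cab' bij_betw_imp_inj_on[OF bij]
    by (intro ker_postcompose_inj[where K = K and i = "pm_map M (c b) b"] map_linear)
      (auto simp: map_comp)
  finally show ?thesis
    by (simp add: I_eq nullity_def)
qed

lemma persistence_module_pm_comp:
  assumes M: "persistence_module K P M" and h: "h \<in> Q \<rightarrow> P" "mono_on Q h"
  shows "persistence_module K Q (pm_comp M h)"
proof -
  interpret persistence_module K P M by fact
  have hQ: "h a \<in> P" if "a \<in> Q" for a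
    using h that by auto
  have h_mono: "h a \<le> h b" if "a \<in> Q" "b \<in> Q" "a \<le> b" for a b
    using h that by (auto dest: mono_onD)
  show ?thesis
  proof (intro persistence_module.intro persistence_module_axioms.intro)
    show "field K" ..
  qed (simp_all add: pm_comp_def hQ h_mono obj_vectorspace obj_fin_dim map_linear map_id map_comp)
qed

text \<open>
  The operator is \<open>d = f \<circ> c \<circ> g\<close>. The counit and \<open>c \<le> id\<close> give \<open>d \<le> id\<close>, and the unit gives
  \<open>c (g a) \<le> g (d a) \<le> g a\<close>. Hence \<open>g (d a)\<close> and \<open>g a\<close> have the same image under \<open>c\<close>, which
  makes \<open>d\<close> idempotent and the maps \<open>M(g (d a) \<le> g a)\<close> isomorphisms; these form the natural
  isomorphism.
\<close>

lemma constructible_pm_comp_right_adjoint: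
  assumes M: "persistence_module K P M" and cons: "constructible K P M"
    and adj: "left_adjoint P Q f g" and g: "g \<in> Q \<rightarrow> P"
  shows "constructible K Q (pm_comp M g)"
proof -
  interpret persistence_module K P M by fact
  obtain c where c: "co_closure_operator P c" and fin: "finite (c ` P)"
    and iso: "pm_iso K P (pm_comp M c) M"
    using cons by (auto simp: constructible_def)
  have cP: "c p \<in> P" "c p \<le> p" "c (c p) = c p" if "p \<in> P" for p
    using c that by (auto simp: co_closure_operator_def)
  have c_mono: "c p \<le> c q" if "p \<in> P" "q \<in> P" "p \<le> q" for p q
    using c that by (auto simp: co_closure_operator_def dest: mono_onD)
  have gQ: "g a \<in> P" if "a \<in> Q" for a
    using g that by auto
  have g_mono: "g a \<le> g b" if "a \<in> Q" "b \<in> Q" "a \<le> b" for a b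
    using right_adjoint_mono[OF adj g] that by (auto dest: mono_onD)
  have fP: "f p \<in> Q" if "p \<in> P" for p
    using adj that by (auto simp: left_adjoint_def)
  have f_mono: "f p \<le> f q" if "p \<in> P" "q \<in> P" "p \<le> q" for p q
    using adj that by (auto simp: left_adjoint_def dest: mono_onD)
  have galois: "f p \<le> a \<longleftrightarrow> p \<le> g a" if "p \<in> P" "a \<in> Q" for p a
    using adj that by (auto simp: left_adjoint_def)
  define d where "d = f \<circ> c \<circ> g"
  have dQ: "d a \<in> Q" if "a \<in> Q" for a
    using that by (simp add: d_def fP cP gQ)
  have d_le: "d a \<le> a" if "a \<in> Q" for a
    using that by (simp add: d_def galois cP gQ)
  have c_le_gd: "c (g a) \<le> g (d a)" if "a \<in> Q" for a
    using that dQ[OF that] galois[of "c (g a)" "d a"] by (simp add: d_def cP gQ)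
  have c_gd: "c (g (d a)) = c (g a)" if a: "a \<in> Q" for a
  proof (rule antisym)
    show "c (g (d a)) \<le> c (g a)"
      using a by (intro c_mono gQ g_mono dQ d_le)
    have "c (c (g a)) \<le> c (g (d a))"
      using a by (intro c_mono cP gQ dQ c_le_gd)
    then show "c (g a) \<le> c (g (d a))"
      using cP(3)[OF gQ[OF a]] by simp
  qed
  have d_mono: "d a \<le> d b" if "a \<in> Q" "b \<in> Q" "a \<le> b" for a b
    unfolding d_def comp_def using that by (intro f_mono cP c_mono gQ g_mono)
  have "d (d a) = d a" if "a \<in> Q" for a
    using c_gd[OF that] by (simp add: d_def)
  then have "co_closure_operator Q d"
    using dQ d_le d_mono by (auto simp: co_closure_operator_def intro: mono_onI)
  moreover have "finite (d ` Q)"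
  proof (rule finite_subset)
    show "d ` Q \<subseteq> f ` (c ` P)"
      using gQ by (auto simp: d_def)
  qed (use fin in simp)
  moreover have "pm_iso K Q (pm_comp (pm_comp M g) d) (pm_comp M g)"
    unfolding pm_iso_def
  proof (intro exI[of _ "\<lambda>a. pm_map M (g (d a)) (g a)"] conjI ballI impI)
    fix a assume a: "a \<in> Q"
    show "linear_map K (pm_obj (pm_comp (pm_comp M g) d) a) (pm_obj (pm_comp M g) a)
        (pm_map M (g (d a)) (g a))"
      using a by (simp add: pm_comp_def map_linear gQ dQ g_mono d_le)
    show "bij_betw (pm_map M (g (d a)) (g a)) (carrier (pm_obj (pm_comp (pm_comp M g) d) a))
        (carrier (pm_obj (pm_comp M g) a))"
      using map_bij_if_coclosure_eq[OF M c iso gQ[OF dQ[OF a]] gQ[OF a] _ c_gd[OF a]] a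
      by (simp add: pm_comp_def g_mono dQ d_le)
  next
    fix a b x assume "a \<in> Q" "b \<in> Q" "a \<le> b"
      and "x \<in> carrier (pm_obj (pm_comp (pm_comp M g) d) a)"
    then show "pm_map M (g (d b)) (g b) (pm_map (pm_comp (pm_comp M g) d) a b x) =
        pm_map (pm_comp M g) a b (pm_map M (g (d a)) (g a) x)"
      by (simp add: pm_comp_def map_comp gQ dQ g_mono d_le d_mono)
  qed
  ultimately show ?thesis
    by (auto simp: constructible_def)
qed

lemma moebius_inversion_nullity:
  assumes M: "persistence_module K P M" and cons: "constructible K P M"
  shows "is_moebius_inversion (intervals P) (nullity K M)
      (moebius_inversion (intervals P) (nullity K M))"
    and "finite {I. moebius_inversion (intervals P) (nullity K M) I \<noteq> 0}"
proof -
  obtain c where c: "co_closure_operator P c" and fin: "finite (c ` P)"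
    and iso: "pm_iso K P (pm_comp M c) M"
    using cons by (auto simp: constructible_def)
  note inversion = moebius_inversion_co_closure
      [where m = "nullity K M" and c = "map_prod c c" and X = "intervals P",
        OF co_closure_operator_intervals[OF c] finite_image_intervals[OF fin]
          nullity_coclosure[OF M c iso]]
  show "is_moebius_inversion (intervals P) (nullity K M)
      (moebius_inversion (intervals P) (nullity K M))"
    and "finite {I. moebius_inversion (intervals P) (nullity K M) I \<noteq> 0}"
    using inversion by blast+
qed

section \<open>Restriction along a right adjoint\<close>

lemma nullity_pm_comp: "nullity K (pm_comp M h) = nullity K M \<circ> map_prod h h"
  by (auto simp: nullity_def pm_comp_def)

lemma moebius_inversion_nullity_pm_comp:
  assumes M: "persistence_module K P M" and cons: "constructible K P M"
    and adj: "left_adjoint P Q f g" and g: "g \<in> Q \<rightarrow> P"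
  shows "moebius_inversion (intervals Q) (nullity K (pm_comp M g)) =
    pushforward P f (moebius_inversion (intervals P) (nullity K M))"
proof (rule moebius_inversion_eqI)
  let ?w = "moebius_inversion (intervals P) (nullity K M)"
  show "is_moebius_inversion (intervals Q) (nullity K (pm_comp M g)) (pushforward P f ?w)"
    unfolding nullity_pm_comp
    by (rule moebius_inversion_pushforward[OF adj g moebius_inversion_nullity[OF M cons]])
  fix J assume J: "J \<notin> intervals Q"
  have "f \<in> P \<rightarrow> Q" "mono_on P f"
    using adj by (auto simp: left_adjoint_def)
  then have not_J: "map_prod f f I \<noteq> J" if "I \<in> intervals P" for I
    using map_prod_intervals that J by metis
  show "pushforward P f ?w J = 0"
  proof (rule ccontr)
    assume "pushforward P f ?w J \<noteq> 0"
    then obtain I where "I \<in> intervals P" "map_prod f f I = J"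
      by (rule pushforward_nonzeroE)
    with not_J show False
      by simp
  qed
qed

theorem proposition7p16:
  fixes K :: "'k ring"
    and M :: "(real^'n, 'k, 'v) pmod"
    and \<l> :: "(real^'n) set"
    and \<iota> :: "real \<Rightarrow> real^'n"
    and \<pi> :: "real^'n \<Rightarrow> real"
  assumes "persistence_module K {0..} M"
    and "constructible K {0..} M"
    and "nonneg_slope_line \<l>"
    and "mono_on {0..} \<iota>"
    and "bij_betw \<iota> {0..} \<l>"
    and "left_adjoint {0..} {0..} \<pi> \<iota>"
  shows "is_persistence_diagram K {0..} (pm_comp M \<iota>)
           (pushforward {0..} \<pi> (moebius_inversion (intervals {0..}) (nullity K M)))"
proof -
  have "\<l> \<subseteq> {0..}"
    using assms(3) by (auto simp: nonneg_slope_line_def)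
  then have \<iota>: "\<iota> \<in> {0..} \<rightarrow> {0..}"
    using assms(5) by (auto simp: bij_betw_def)
  let ?w = "moebius_inversion (intervals {0..}) (nullity K M)"
  have "finite {J. pushforward {0..} \<pi> ?w J \<noteq> 0}"
    by (rule finite_support_pushforward[OF moebius_inversion_nullity(2)[OF assms(1,2)]])
  then have "finite {J \<in> intervals {0..}. pushforward {0..} \<pi> ?w J \<noteq> 0}"
    by (rule rev_finite_subset) auto
  then show ?thesis
    unfolding is_persistence_diagram_def
    using persistence_module_pm_comp[OF assms(1) \<iota> assms(4)]
      constructible_pm_comp_right_adjoint[OF assms(1,2,6) \<iota>]
      moebius_inversion_nullity_pm_comp[OF assms(1,2,6) \<iota>]
    by simp
qed

end
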